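(* Let $\pi=(\pi_i)_{i\ge 1}$ be a non-increasing probability distribution on $\mathbb{N}=\{1,2,\ldots\}$ and let $R$ be a random variable with $\mathbb{P}[R=i]=\pi_i$. Suppose that $\pi$ is either a power law with parameter $\alpha>1$ or asymptotically geometric with parameter $0<\nu<1$. Let $C(t)$ be the search cost at time $t$ under the transposition rule on the infinite list with i.i.d. requests distributed as $\pi$. Then $$\limsup_{x\to\infty}\ \limsup_{t\to\infty}\ \frac{\log \mathbb{P}[C(t)>x]}{\log\mathbb{P}[R>x]}=1 .$$
   Context: Model. The items are $1,2,3,\ldots$, arranged in an infinite list (each item occupies exactly one position in $\mathbb{N}=\{1,2,\ldots\}$). At each integer time $t=0,1,2,\ldots$ an item $R(t)$ is requested; the $R(t)$ are i.i.d. with $\mathbb{P}[R(t)=i]=\pi_i$, where $\sum_{i\ge1}\pi_i=1$ and $\pi_i\ge\pi_{i+1}$ for all $i$. At time $t=0$ the list is ordered as $1,2,3,\ldots$ (item $i$ is in position $i$). Transposition rule: upon every request, the requested item is moved forward by one position (towards position 1) and the item that was immediately in front of it is moved back by one position, i.e. the two are swapped; if the requested item is in position $1$, the list does not change. $X_i(t)$ is the position of item $i$ in the list at time $t$ (before the request at time $t$ is processed), and $C(t):=X_{R(t)}(t)$ is the search cost at time $t$. $\pi$ is a power law with parameter $\alpha>1$ if $\pi_i=c\,i^{-\alpha}$ for all $i\ge1$, where $c^{-1}=\sum_{i\ge1}i^{-\alpha}$. $\pi$ is asymptotically geometric with parameter $0<\nu<1$ if $i^{-1}\log\pi_i\to\log\nu$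 as $i\to\infty$. The variable $x$ ranges over $\mathbb{N}$. *)

theory Defs
  imports "HOL-Probability.Probability" "HOL-Combinatorics.Transposition"
begin

text \<open>
  Items and positions are the naturals \<open>\<ge> 1\<close>. A list ordering is a function mapping each item to
  its position. The number 0 is a dummy: it is requested with probability 0, and it stays at the
  dummy position 0 forever, because a request for the item in position 1 changes nothing.
\<close>

definition transposition_step :: "nat \<Rightarrow> (nat \<Rightarrow> nat) \<Rightarrow> nat \<Rightarrow> nat" where
  "transposition_step r X =
     (if X r \<le> 1 then X else Transposition.transpose (X r - 1) (X r) \<circ> X)"

text \<open>\<open>position q t i\<close> is the position of item \<open>i\<close> just before the request \<open>q t\<close> is processed.\<close>

primrec position :: "(nat \<Rightarrow> nat) \<Rightarrow> nat \<Rightarrow> nat \<Rightarrow> nat" where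
  "position q 0 = id"
| "position q (Suc t) = transposition_step (q t) (position q t)"

definition search_cost :: "(nat \<Rightarrow> nat) \<Rightarrow> nat \<Rightarrow> nat" where
  "search_cost q t = position q t (q t)"

definition power_law :: "nat pmf \<Rightarrow> real \<Rightarrow> bool" where
  "power_law p \<alpha> \<longleftrightarrow>
     (\<forall>i\<ge>1. pmf p i = inverse (\<Sum>\<^sub>\<infinity>j\<in>{1..}. real j powr (- \<alpha>)) * real i powr (- \<alpha>))"

text \<open>
  The convention \<open>ln 0 = 0\<close> is harmless here: if \<open>pmf p i = 0\<close> for infinitely many \<open>i\<close>, the
  quotient is 0 infinitely often and cannot converge to \<open>ln \<nu> < 0\<close>.
\<close>

definition asymptotically_geometric :: "nat pmf \<Rightarrow> real \<Rightarrow> bool" where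
  "asymptotically_geometric p \<nu> \<longleftrightarrow> (\<lambda>i. ln (pmf p i) / real i) \<longlonglongrightarrow> ln \<nu>"

end

theory Submission
  imports Defs "HOL-Real_Asymp.Real_Asymp"
begin

text \<open>
  Whatever the order of the list, the items in the first \<open>x\<close> positions carry at most the mass of the
  \<open>x\<close> most popular items, so \<open>P(C(t) > x) \<ge> P(R > x)\<close> at every time and the quotient of logarithms
  is at most 1 (\<open>request_tail_le_cost_tail\<close>). It remains to bound \<open>P(C(t) > x)\<close> by
  \<open>P(R > x) powr (1 - \<epsilon>)\<close> for large \<open>x\<close>, uniformly in \<open>t\<close> (\<open>limsup_ratio_eq_1\<close>).

  The dynamical input is a bound on how far the \<open>m\<close> most popular items can drift. Colour these items
  black and all others white. Black items are requested with probability at least \<open>a = \<pi>\<^sub>m\<close> and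
  white ones with probability at most \<open>b = \<pi>\<^bsub>m+1\<^esub>\<close>, so at every boundary between two
  adjacent positions the colours perform a biased exclusion dynamics: black moves forward past white at
  rate at least \<open>a\<close>, white moves forward past black at rate at most \<open>b\<close>. Let \<open>H\<^sub>k\<close> be the number of
  black items behind position \<open>k\<close>, and \<open>\<beta> = a / b\<close>. The exponential (Hopf-Cole) transform
  \<open>\<beta> ^ H\<^sub>k\<close> turns this interacting system into a linear one: its expectation is a subsolution
  of the discrete heat equation with drift
  \<open>u\<^sub>k \<leftarrow> b u\<^bsub>k-1\<^esub> + a u\<^bsub>k+1\<^esub> + (1 - a - b) u\<^sub>k\<close>
  (\<open>expectation_overflow_step\<close>). The stationary solution \<open>1 + (\<beta> ^ m - 1) / \<beta> ^ k\<close> dominates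
  the initial data, hence dominates forever. By Markov's inequality, the probability
  that one of the first \<open>m\<close> items is behind position \<open>k\<close> is at most \<open>m (b / a) ^ (k - m)\<close> at all times
  (\<open>prob_some_large_position\<close>).

  Splitting \<open>C(t) > x\<close> according to the requested item (\<open>cost_tail_le\<close>) leaves a choice of \<open>m\<close>. For a
  power law, one cut at \<open>m \<approx> x powr (1 - \<epsilon> / 3)\<close> suffices: the drift term then decays
  faster than every power of \<open>x\<close>. For asymptotically geometric \<open>\<pi>\<close> single ratios \<open>b / a\<close> may be close
  to 1, but in every window of length about \<open>d x\<close> some ratio is at most about \<open>\<nu>\<close>, and
  item \<open>i\<close> is treated with such an \<open>m\<close> found just above \<open>i\<close>. Then \<open>\<pi>\<^sub>i P(X\<^sub>i > x)\<close> is about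
  \<open>\<nu> ^ i \<nu> ^ (x - i)\<close> for every \<open>i\<close>, up to factors that the loss \<open>\<epsilon>\<close> absorbs.
\<close>

section \<open>The law of the list order\<close>
text \<open>
  The most recent request comes first, so that the list order is a right fold.
\<close>
definition request_history :: "(nat \<Rightarrow> 'b \<Rightarrow> nat) \<Rightarrow> nat \<Rightarrow> 'b \<Rightarrow> nat list" where
  "request_history R t \<omega> = map (\<lambda>s. R s \<omega>) (rev [0..<t])"

lemma request_history_Suc:
  "request_history R (Suc t) \<omega> = R t \<omega> # request_history R t \<omega>"
  by (simp add: request_history_def)

lemma position_eq_foldr:
  "position (\<lambda>s. R s \<omega>) t = foldr transposition_step (request_history R t \<omega>) id"
  by (induction t) (simp_all add: request_history_def)

text \<open>
  Boundedness makes all integrals finite, so the identity for nonnegative extended integrals descends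
  to the reals.
\<close>
lemma integral_bind_pmf_bounded:
  fixes f :: "'b \<Rightarrow> real"
  assumes nonneg: "\<And>y. 0 \<le> f y" and le: "\<And>y. f y \<le> B"
  shows "(\<integral>y. f y \<partial>bind_pmf M N) = (\<integral>x. (\<integral>y. f y \<partial>N x) \<partial>M)"
proof -
  have int: "integrable (measure_pmf P) f" for P
    by (rule measure_pmf.integrable_const_bound[where B=B]) (auto simp: nonneg le)
  have B: "0 \<le> B" using nonneg le order_trans by blast
  have in1: "(\<integral>y. f y \<partial>P) \<le> B" for P :: "'b pmf"
    using integral_mono[OF int[of P], of "\<lambda>_. B"] le by simp
  have int2: "integrable (measure_pmf M) (\<lambda>x. \<integral>y. f y \<partial>N x)"
    by (rule measure_pmf.integrable_const_bound[where B=B]) (auto simp: nonneg in1)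
  have "ennreal (\<integral>y. f y \<partial>bind_pmf M N) = (\<integral>\<^sup>+x. \<integral>\<^sup>+y. f y \<partial>N x \<partial>M)"
    by (subst nn_integral_eq_integral[OF int, symmetric]) (auto simp: nonneg)
  also have "\<dots> = (\<integral>\<^sup>+x. ennreal (\<integral>y. f y \<partial>N x) \<partial>M)"
    by (subst nn_integral_eq_integral[OF int]) (auto simp: nonneg)
  also have "\<dots> = ennreal (\<integral>x. (\<integral>y. f y \<partial>N x) \<partial>M)"
    by (rule nn_integral_eq_integral[OF int2]) (auto simp: nonneg)
  finally show ?thesis
    by (subst (asm) ennreal_inj) (auto simp: nonneg)
qed

lemma pmf_replicate_pmf:
  "pmf (replicate_pmf n p) xs = (if length xs = n then prod_list (map (pmf p) xs) else 0)"
proof (induction n arbitrary: xs)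
  case 0
  then show ?case by (auto simp: indicator_def)
next
  case (Suc n)
  have eq: "replicate_pmf (Suc n) p = map_pmf (\<lambda>(x, ys). x # ys) (pair_pmf p (replicate_pmf n p))"
    by (simp add: pair_pmf_def map_bind_pmf bind_return_pmf)
  show ?case
  proof (cases xs)
    case Nil
    then show ?thesis by (simp add: pmf_eq_0_set_pmf set_replicate_pmf del: replicate_pmf.simps)
  next
    case (Cons y ys)
    have "pmf (replicate_pmf (Suc n) p) xs = pmf (pair_pmf p (replicate_pmf n p)) (y, ys)"
      unfolding eq Cons using pmf_map_inj'[of "\<lambda>(x, ys). x # ys" "pair_pmf p (replicate_pmf n p)" "(y, ys)"]
      by (simp add: inj_def)
    then show ?thesis by (simp add: pmf_pair Suc.IH Cons)
  qed
qed

text \<open>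
  Histories range over a countable type, so their law is determined by the point masses, which
  factorize by independence.
\<close>
lemma (in prob_space) request_history_law:
  fixes \<pi> :: "nat pmf"
  assumes indep: "indep_vars (\<lambda>_. count_space UNIV) R UNIV"
    and distr: "\<And>t i. prob {\<omega> \<in> space M. R t \<omega> = i} = pmf \<pi> i"
  shows "prob {\<omega> \<in> space M. P (request_history R t \<omega>)} = measure_pmf.prob (replicate_pmf t \<pi>) {h. P h}"
proof -
  have R: "R s \<in> measurable M (count_space UNIV)" for s
    using indep by (auto simp: indep_vars_def)
  have hist: "request_history R t \<in> measurable M (count_space UNIV)" for t
  proof (induction t)
    case 0
    then show ?case by (simp add: request_history_def[abs_def])
  next
    case (Suc t)
    have "(\<lambda>\<omega>. (case (R t \<omega>, request_history R t \<omega>) of (r, h) \<Rightarrow> r # h))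
            \<in> measurable M (count_space UNIV)"
      by (rule measurable_compose[OF measurable_Pair[OF R Suc]])
         (simp add: pair_measure_countable)
    then show ?case by (simp add: request_history_Suc[abs_def])
  qed
  have point: "prob {\<omega> \<in> space M. request_history R t \<omega> = l} = pmf (replicate_pmf t \<pi>) l" for t l
  proof (cases "length l = t")
    case False
    then have "{\<omega> \<in> space M. request_history R t \<omega> = l} = {}"
      by (auto simp: request_history_def)
    then show ?thesis using False by (simp only: pmf_replicate_pmf measure_empty if_False)
  next
    case len: True
    show ?thesis
    proof (cases "t = 0")
      case True
      then show ?thesis using len by (simp add: request_history_def prob_space)
    next
      case False
      let ?l = "rev l"
      have "{\<omega> \<in> space M. request_history R t \<omega> = l} = (\<Inter>s\<in>{..<t}. R s -` {?l ! s} \<inter> space M)"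
      proof -
        have "request_history R t \<omega> = l \<longleftrightarrow> (\<forall>s<t. R s \<omega> = ?l ! s)" for \<omega>
        proof -
          have "request_history R t \<omega> = l \<longleftrightarrow> map (\<lambda>s. R s \<omega>) [0..<t] = ?l"
            unfolding request_history_def rev_map[symmetric] by (metis rev_rev_ident)
          also have "\<dots> \<longleftrightarrow> (\<forall>s<t. R s \<omega> = ?l ! s)"
            using len by (simp add: list_eq_iff_nth_eq)
          finally show ?thesis .
        qed
        then show ?thesis using False by auto
      qed
      then have "prob {\<omega> \<in> space M. request_history R t \<omega> = l}
          = (\<Prod>s<t. prob (R s -` {?l ! s} \<inter> space M))"
        using indep_varsD[OF indep, of "{..<t}" "\<lambda>s. {?l ! s}"] False by auto
      also have "\<dots> = (\<Prod>s<t. pmf \<pi> (?l ! s))"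
        by (rule prod.cong[OF refl]) (simp add: distr vimage_def Int_def conj_commute)
      also have "\<dots> = prod_list (map (pmf \<pi>) ?l)"
        using len by (simp add: prod.list_conv_set_nth atLeast0LessThan)
      also have "\<dots> = prod_list (map (pmf \<pi>) l)"
        by (simp add: rev_map[symmetric] prod_list.rev)
      finally show ?thesis using len by (simp add: pmf_replicate_pmf)
    qed
  qed
  have eq: "distr M (count_space UNIV) (request_history R t) = measure_pmf (replicate_pmf t \<pi>)"
  proof (rule measure_eqI_countable[where A=UNIV])
    fix l :: "nat list"
    have "emeasure (distr M (count_space UNIV) (request_history R t)) {l}
      = emeasure M {\<omega> \<in> space M. request_history R t \<omega> = l}"
      by (simp add: emeasure_distr[OF hist] vimage_def Int_def conj_commute)
    also have "\<dots> = emeasure (measure_pmf (replicate_pmf t \<pi>)) {l}"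
      by (simp add: emeasure_eq_measure point emeasure_pmf_single)
    finally show "emeasure (distr M (count_space UNIV) (request_history R t)) {l}
      = emeasure (measure_pmf (replicate_pmf t \<pi>)) {l}" .
  qed auto
  have "prob {\<omega> \<in> space M. P (request_history R t \<omega>)}
      = measure (distr M (count_space UNIV) (request_history R t)) {h. P h}"
    by (simp add: measure_distr[OF hist] vimage_def Int_def conj_commute)
  then show ?thesis by (simp add: eq)
qed

text \<open>
  The law of the list order at time \<open>t\<close>, as a function from items to positions. It depends on the
  request distribution only, which frees everything below from the probability space \<open>M\<close>.
\<close>
definition order_law :: "nat pmf \<Rightarrow> nat \<Rightarrow> (nat \<Rightarrow> nat) pmf" where
  "order_law p t = map_pmf (\<lambda>h. foldr transposition_step h id) (replicate_pmf t p)"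

lemma order_law_0: "order_law p 0 = return_pmf id"
  by (simp add: order_law_def)

lemma order_law_Suc:
  "order_law p (Suc t) = bind_pmf (order_law p t) (\<lambda>X. map_pmf (\<lambda>r. transposition_step r X) p)"
  unfolding order_law_def
  by (simp add: map_bind_pmf bind_map_pmf map_pmf_def bind_assoc_pmf bind_return_pmf)
     (rule bind_commute_pmf)

text \<open>
  The request at time \<open>t\<close> is independent of the order it meets, so the cost tail is the mean mass of the
  items lying behind position \<open>x\<close>.
\<close>
lemma (in prob_space) search_cost_tail:
  fixes \<pi> :: "nat pmf"
  assumes indep: "indep_vars (\<lambda>_. count_space UNIV) R UNIV"
    and distr: "\<And>t i. prob {\<omega> \<in> space M. R t \<omega> = i} = pmf \<pi> i"
  shows "prob {\<omega> \<in> space M. search_cost (\<lambda>s. R s \<omega>) t > x}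
       = (\<integral>X. measure_pmf.prob \<pi> {r. X r > x} \<partial>order_law \<pi> t)"
proof -
  \<comment> \<open>The history at time \<open>t + 1\<close> contains the current request as its head.\<close>
  let ?P = "\<lambda>h. foldr transposition_step (tl h) id (hd h) > x"
  have "prob {\<omega> \<in> space M. search_cost (\<lambda>s. R s \<omega>) t > x}
      = prob {\<omega> \<in> space M. ?P (request_history R (Suc t) \<omega>)}"
    by (simp add: search_cost_def position_eq_foldr request_history_Suc)
  also have "\<dots> = measure_pmf.prob (replicate_pmf (Suc t) \<pi>) {h. ?P h}"
    by (rule request_history_law[OF indep distr])
  also have "replicate_pmf (Suc t) \<pi>
      = bind_pmf (replicate_pmf t \<pi>) (\<lambda>h. map_pmf (\<lambda>r. r # h) \<pi>)"
    by (simp add: map_pmf_def) (rule bind_commute_pmf)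
  also have "measure_pmf.prob \<dots> {h. ?P h}
      = (\<integral>y. indicator {h. ?P h} y \<partial>bind_pmf (replicate_pmf t \<pi>) (\<lambda>h. map_pmf (\<lambda>r. r # h) \<pi>))"
    by simp
  also have "\<dots> = (\<integral>h. \<integral>y. indicator {h. ?P h} y \<partial>map_pmf (\<lambda>r. r # h) \<pi> \<partial>replicate_pmf t \<pi>)"
    by (rule integral_bind_pmf_bounded[where B=1]) (auto simp: indicator_def)
  also have "\<dots> = (\<integral>X. measure_pmf.prob \<pi> {r. X r > x} \<partial>order_law \<pi> t)"
    by (simp add: order_law_def vimage_def del: integral_map_pmf add: integral_map_pmf[of _ _ "\<lambda>X. measure_pmf.prob \<pi> {r. X r > x}"])
  finally show ?thesis .
qed

section \<open>Drift of the most popular items\<close>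
lemma order_law_support:
  assumes X: "X \<in> set_pmf (order_law p t)"
  shows "bij X \<and> X 0 = 0"
  using X
proof (induction t arbitrary: X)
  case 0
  then show ?case by (simp add: order_law_0 bij_id[unfolded id_def] id_def)
next
  case (Suc t)
  then obtain Y r where "Y \<in> set_pmf (order_law p t)" and X: "X = transposition_step r Y"
    by (auto simp: order_law_Suc)
  then have Y: "bij Y" "Y 0 = 0" using Suc.IH by auto
  show ?case
    using Y by (auto simp: X transposition_step_def bij_comp Transposition.transpose_def)
qed

text \<open>
  The height function \<open>H\<^sub>k\<close> of the exclusion dynamics of the first \<open>m\<close> items. A request changes it only
  if it moves an item across the boundary between positions \<open>k\<close> and \<open>k + 1\<close>.
\<close>
definition overflow :: "nat \<Rightarrow> nat \<Rightarrow> (nat \<Rightarrow> nat) \<Rightarrow> nat" where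
  "overflow m k X = card {i \<in> {1..m}. X i > k}"

lemma overflow_le: "overflow m k X \<le> m"
proof -
  have "card {i \<in> {1..m}. X i > k} \<le> card {1..m}" by (rule card_mono) auto
  then show ?thesis by (simp add: overflow_def)
qed

lemma overflow_diff:
  assumes "inj X" "X i = Suc k" "X 0 = 0"
  shows "overflow m k X = overflow m (Suc k) X + (if i \<le> m then 1 else 0)"
proof -
  have i: "i \<ge> 1" using assms by (cases i) auto
  have iff: "X j > k \<longleftrightarrow> X j > Suc k \<or> j = i" for j
  proof -
    have "X j = Suc k \<longleftrightarrow> j = i"
      using assms(2) injD[OF assms(1), of j i] by auto
    then show ?thesis by auto
  qed
  show ?thesis
  proof (cases "i \<le> m")
    case True
    have "{j \<in> {1..m}. X j > k} = insert i {j \<in> {1..m}. X j > Suc k}"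
      unfolding iff using i True by auto
    then show ?thesis using True assms(2) by (simp add: overflow_def)
  next
    case False
    have "{j \<in> {1..m}. X j > k} = {j \<in> {1..m}. X j > Suc k}"
      unfolding iff using False by auto
    then show ?thesis using False by (simp add: overflow_def)
  qed
qed

lemma overflow_transposition_step_other:
  assumes "inj X" "X r \<noteq> Suc k"
  shows "overflow m k (transposition_step r X) = overflow m k X"
proof -
  have "transposition_step r X i > k \<longleftrightarrow> X i > k" for i
    using assms(2) by (auto simp: transposition_step_def Transposition.transpose_def)
  then show ?thesis by (simp add: overflow_def)
qed

lemma overflow_transposition_step_front:
  assumes X: "inj X" "X 0 = 0" and k: "k \<ge> 1" and i: "X i = Suc k" and j: "X j = k"
  shows "overflow m k (transposition_step i X) = overflow m (Suc k) X + (if j \<le> m then 1 else 0)"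
proof -
  let ?Y = "transposition_step i X"
  have Y: "?Y = Transposition.transpose k (Suc k) \<circ> X"
    using i k by (simp add: transposition_step_def)
  have "inj ?Y" unfolding Y using X(1) by (simp add: inj_compose)
  moreover have "?Y j = Suc k" "?Y 0 = 0" using j X k unfolding Y by (auto simp: Transposition.transpose_def)
  ultimately have "overflow m k ?Y = overflow m (Suc k) ?Y + (if j \<le> m then 1 else 0)"
    by (intro overflow_diff)
  moreover have "overflow m (Suc k) ?Y = overflow m (Suc k) X"
    by (rule overflow_transposition_step_other) (use X i in auto)
  ultimately show ?thesis by simp
qed

text \<open>
  Only a request of the item \<open>i\<close> in position \<open>k + 1\<close> matters; let \<open>j\<close> be the item in position \<open>k\<close>.
  If both or neither of \<open>i\<close> and \<open>j\<close> are among the first \<open>m\<close> items, both sides agree, because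
  \<open>\<beta> b = a\<close>. In the other two cases the right-hand side is the value that the left-hand side would have
  if \<open>i\<close> had probability exactly \<open>a\<close> (and the swap lowers the height) or exactly \<open>b\<close> (and the swap raises it).
\<close>
lemma expectation_overflow_step:
  fixes p :: "nat pmf" and \<beta> a b :: real
  assumes X: "bij X" "X 0 = 0" and k: "k \<ge> 1"
    and hi: "\<And>i. 1 \<le> i \<Longrightarrow> i \<le> m \<Longrightarrow> pmf p i \<ge> a"
    and lo: "\<And>i. m < i \<Longrightarrow> pmf p i \<le> b"
    and b: "0 < b" "b \<le> a" and lam: "\<beta> * b = a"
  shows "(\<integral>r. \<beta> ^ overflow m k (transposition_step r X) \<partial>p)
    \<le> b * \<beta> ^ overflow m (k - 1) X + a * \<beta> ^ overflow m (Suc k) X + (1 - a - b) * \<beta> ^ overflow m k X"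
proof -
  have inj: "inj X" using X by (simp add: bij_def)
  obtain i where i: "X i = Suc k" using surjD[OF bij_is_surj[OF X(1)], of "Suc k"] by auto
  obtain j where j: "X j = k" using surjD[OF bij_is_surj[OF X(1)], of "k"] by auto
  have i1: "i \<ge> 1" using X i by (cases i) auto
  let ?h = "overflow m k X"
  let ?g = "overflow m (Suc k) X"
  have lam1: "\<beta> \<ge> 1" using mult_strict_right_mono[of \<beta> 1 b] b lam by linarith
  have hk: "?h = ?g + (if i \<le> m then 1 else 0)"
    by (rule overflow_diff[OF inj i X(2)])
  have hk1: "overflow m (k - 1) X = ?h + (if j \<le> m then 1 else 0)"
    using overflow_diff[OF inj _ X(2), of j "k - 1" m] j k by simp
  let ?h' = "?g + (if j \<le> m then 1 else 0)"
  have "\<beta> ^ overflow m k (transposition_step r X)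
      = \<beta> ^ ?h + indicator {i} r * (\<beta> ^ ?h' - \<beta> ^ ?h)" for r
  proof (cases "r = i")
    case True
    then show ?thesis
      using overflow_transposition_step_front[OF inj X(2) k i j, of m] by simp
  next
    case False
    then have "X r \<noteq> Suc k" using i inj by (metis injD)
    then show ?thesis
      using overflow_transposition_step_other[OF inj] False by (simp add: indicator_def)
  qed
  moreover have "(\<integral>r. c + indicator {i} r * d \<partial>p) = c + pmf p i * d" for c d :: real
  proof -
    have "integrable (measure_pmf p) (\<lambda>r. indicator {i} r * d)"
      by (rule measure_pmf.integrable_const_bound[where B="\<bar>d\<bar>"]) (auto simp: indicator_def)
    then show ?thesis by (simp add: measure_pmf_single)
  qed
  ultimately have E: "(\<integral>r. \<beta> ^ overflow m k (transposition_step r X) \<partial>p)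
      = \<beta> ^ ?h + pmf p i * (\<beta> ^ ?h' - \<beta> ^ ?h)"
    by presburger
  \<comment> \<open>Expressing all heights by the one at \<open>k + 1\<close> keeps the four cases polynomial in \<open>\<beta>\<close>.\<close>
  define G where "G = \<beta> ^ ?g"
  have G: "G > 0" unfolding G_def using lam1 by simp
  show ?thesis
  proof (cases "i \<le> m")
    case im: True
    show ?thesis
    proof (cases "j \<le> m")
      case True
      have e: "\<beta> * G + pmf p i * (\<beta> * G - \<beta> * G) = b * (\<beta> * (\<beta> * G)) + a * G + (1 - a - b) * (\<beta> * G)"
        unfolding lam[symmetric] by (simp add: algebra_simps)
      show ?thesis using e unfolding E hk1 hk using im True by (simp add: G_def)
    next
      case False
      have "pmf p i * (G - \<beta> * G) \<le> a * (G - \<beta> * G)"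
        using hi[OF i1 im] lam1 G by (intro mult_right_mono_neg) auto
      then have "\<beta> * G + pmf p i * (G - \<beta> * G) \<le> b * (\<beta> * G) + a * G + (1 - a - b) * (\<beta> * G)"
        by (simp add: algebra_simps)
      then show ?thesis unfolding E hk1 hk using im False by (simp add: G_def)
    qed
  next
    case im: False
    show ?thesis
    proof (cases "j \<le> m")
      case True
      have "pmf p i * (\<beta> * G - G) \<le> b * (\<beta> * G - G)"
        using lo[of i] im lam1 G by (intro mult_right_mono) auto
      then have "G + pmf p i * (\<beta> * G - G) \<le> b * (\<beta> * G) + a * G + (1 - a - b) * G"
        by (simp add: algebra_simps)
      then show ?thesis unfolding E hk1 hk using im True by (simp add: G_def)
    next
      case False
      then show ?thesis unfolding E hk1 hk using im by (simp add: algebra_simps)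
    qed
  qed
qed

text \<open>
  Induction over time: the right-hand side is a fixed point of the linear recursion, because both
  \<open>1\<close> and \<open>\<beta> ^ (- k)\<close> are; at \<open>k = 0\<close> it is the trivial bound \<open>\<beta> ^ m\<close>.
\<close>
lemma expectation_overflow_le:
  fixes p :: "nat pmf" and \<beta> a b :: real
  assumes hi: "\<And>i. 1 \<le> i \<Longrightarrow> i \<le> m \<Longrightarrow> pmf p i \<ge> a"
    and lo: "\<And>i. m < i \<Longrightarrow> pmf p i \<le> b"
    and b: "0 < b" "b \<le> a" and lam: "\<beta> * b = a" and ab: "a + b \<le> 1"
  shows "(\<integral>X. \<beta> ^ overflow m k X \<partial>order_law p t) \<le> 1 + (\<beta> ^ m - 1) / \<beta> ^ k"
proof (induction t arbitrary: k)
  have lam1: "\<beta> \<ge> 1" using mult_strict_right_mono[of \<beta> 1 b] b lam by linarith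
  {
    case 0
    have "overflow m k id = m - k"
    proof -
      have "{i \<in> {1..m}. id i > k} = {k<..m}" by auto
      then show ?thesis by (simp add: overflow_def)
    qed
    moreover have "\<beta> ^ (m - k) \<le> 1 + (\<beta> ^ m - 1) / \<beta> ^ k"
    proof (cases "k \<le> m")
      case True
      have "(1::real) / \<beta> ^ k \<le> 1" using lam1 by simp
      then show ?thesis using True lam1 by (simp add: power_diff diff_divide_distrib)
    next
      case False
      then show ?thesis using lam1 by simp
    qed
    ultimately show ?case by (simp add: order_law_0)
  next
    case (Suc t)
    have bound: "0 \<le> \<beta> ^ overflow m k X" "\<beta> ^ overflow m k X \<le> \<beta> ^ m" for k X
      using lam1 overflow_le by (auto intro!: power_increasing)
    have int: "integrable (measure_pmf q) (\<lambda>X. \<beta> ^ overflow m k (f X))" for q :: "'z pmf" and k f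
      by (rule measure_pmf.integrable_const_bound[where B="\<beta> ^ m"]) (use bound in auto)
    show ?case
    proof (cases "k = 0")
      case True
      have "(\<integral>X. \<beta> ^ overflow m k X \<partial>order_law p (Suc t)) \<le> (\<integral>X. \<beta> ^ m \<partial>order_law p (Suc t))"
        using int[of _ k "\<lambda>x. x"] bound by (intro integral_mono) auto
      then show ?thesis using True by simp
    next
      case False
      let ?E = "\<lambda>k. \<integral>X. \<beta> ^ overflow m k X \<partial>order_law p t"
      have "(\<integral>X. \<beta> ^ overflow m k X \<partial>order_law p (Suc t))
          = (\<integral>X. (\<integral>r. \<beta> ^ overflow m k (transposition_step r X) \<partial>p) \<partial>order_law p t)"
        unfolding order_law_Suc by (subst integral_bind_pmf_bounded[where B="\<beta> ^ m"]) (use bound in auto)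
      also have "\<dots> \<le> (\<integral>X. b * \<beta> ^ overflow m (k - 1) X + a * \<beta> ^ overflow m (Suc k) X
                           + (1 - a - b) * \<beta> ^ overflow m k X \<partial>order_law p t)"
      proof (rule integral_mono_AE)
        have "(\<integral>r. \<beta> ^ overflow m k (transposition_step r X) \<partial>p) \<le> \<beta> ^ m" for X
          using integral_mono[OF int[of p k "\<lambda>r. transposition_step r X"], of "\<lambda>_. \<beta> ^ m"] bound by simp
        then show "integrable (measure_pmf (order_law p t))
            (\<lambda>X. \<integral>r. \<beta> ^ overflow m k (transposition_step r X) \<partial>p)"
          by (intro measure_pmf.integrable_const_bound[where B="\<beta> ^ m"]) (use bound in auto)
        show "integrable (measure_pmf (order_law p t))
            (\<lambda>X. b * \<beta> ^ overflow m (k - 1) X + a * \<beta> ^ overflow m (Suc k) X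
                           + (1 - a - b) * \<beta> ^ overflow m k X)"
          using int[of _ _ "\<lambda>x. x"] by auto
        show "AE X in order_law p t. (\<integral>r. \<beta> ^ overflow m k (transposition_step r X) \<partial>p)
            \<le> b * \<beta> ^ overflow m (k - 1) X + a * \<beta> ^ overflow m (Suc k) X
              + (1 - a - b) * \<beta> ^ overflow m k X"
          unfolding AE_measure_pmf_iff
        proof
          fix X assume "X \<in> set_pmf (order_law p t)"
          then have X: "bij X" "X 0 = 0" using order_law_support by auto
          have "k \<ge> 1" using False by simp
          then show "(\<integral>r. \<beta> ^ overflow m k (transposition_step r X) \<partial>p)
            \<le> b * \<beta> ^ overflow m (k - 1) X + a * \<beta> ^ overflow m (Suc k) X
              + (1 - a - b) * \<beta> ^ overflow m k X"
            by (rule expectation_overflow_step[OF X _ hi lo b lam])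
        qed
      qed
      also have "\<dots> = b * ?E (k - 1) + a * ?E (Suc k) + (1 - a - b) * ?E k"
        using int[of _ _ "\<lambda>x. x"] by simp
      also have "\<dots> \<le> b * (1 + (\<beta> ^ m - 1) / \<beta> ^ (k - 1)) + a * (1 + (\<beta> ^ m - 1) / \<beta> ^ Suc k)
          + (1 - a - b) * (1 + (\<beta> ^ m - 1) / \<beta> ^ k)"
        using b ab by (intro add_mono mult_left_mono Suc.IH) auto
      also have "\<dots> = 1 + (\<beta> ^ m - 1) / \<beta> ^ k"
      proof -
        obtain l where k: "k = Suc l" using False by (cases k) auto
        define D where "D = (\<beta> ^ m - 1) / \<beta> ^ Suc k"
        have "(\<beta> ^ m - 1) / \<beta> ^ k = \<beta> * D" "(\<beta> ^ m - 1) / \<beta> ^ (k - 1) = \<beta> * (\<beta> * D)"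
          using lam1 unfolding D_def k by simp_all
        then show ?thesis unfolding D_def[symmetric] lam[symmetric] by (simp add: algebra_simps)
      qed
      finally show ?thesis .
    qed
  }
qed

text \<open>
  Markov's inequality for \<open>\<beta> ^ overflow - 1\<close>, which is at least \<open>\<beta> - 1\<close> on the event. The factor \<open>m\<close>
  comes from bounding the geometric sum \<open>(\<beta> ^ m - 1) / (\<beta> - 1)\<close> termwise, and keeps the bound
  meaningful as \<open>\<beta>\<close> approaches 1.
\<close>
lemma prob_some_large_position:
  fixes p :: "nat pmf"
  assumes mono: "\<And>i. i \<ge> 1 \<Longrightarrow> pmf p (Suc i) \<le> pmf p i"
    and m: "m \<ge> 1" and pos: "pmf p (Suc m) > 0" and mk: "m \<le> k"
  shows "measure_pmf.prob (order_law p t) {X. \<exists>i\<in>{1..m}. X i > k}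
     \<le> real m * (pmf p (Suc m) / pmf p m) ^ (k - m)"
proof -
  define a b where "a = pmf p m" and "b = pmf p (Suc m)"
  define \<beta> where "\<beta> = a / b"
  have anti: "pmf p j \<le> pmf p i" if "1 \<le> i" "i \<le> j" for i j
    using that(2,1) by (induction rule: dec_induct) (auto intro: order_trans[OF mono])
  have b: "0 < b" "b \<le> a" using pos mono[OF m] by (auto simp: a_def b_def)
  have lam: "\<beta> * b = a" using b by (simp add: \<beta>_def)
  have lam1: "\<beta> \<ge> 1" using b by (simp add: \<beta>_def)
  have "a + b = (\<Sum>i\<in>{m, Suc m}. pmf p i)" by (simp add: a_def b_def)
  also have "\<dots> = measure_pmf.prob p {m, Suc m}" by (rule measure_measure_pmf_finite[symmetric]) auto
  finally have ab: "a + b \<le> 1" by simp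
  have E: "(\<integral>X. \<beta> ^ overflow m k X \<partial>order_law p t) \<le> 1 + (\<beta> ^ m - 1) / \<beta> ^ k"
    by (rule expectation_overflow_le[OF _ _ b lam ab]) (auto simp: a_def b_def anti m)
  let ?A = "{X. \<exists>i\<in>{1..m}. X i > k}"
  have q: "pmf p (Suc m) / pmf p m = 1 / \<beta>" by (simp add: \<beta>_def a_def b_def)
  show ?thesis
  proof (cases "\<beta> = 1")
    case True
    then have "real m * (pmf p (Suc m) / pmf p m) ^ (k - m) = real m" by (simp add: q)
    then show ?thesis using m by (smt (verit) measure_pmf.prob_le_1 of_nat_1 of_nat_mono)
  next
    case False
    then have lam2: "\<beta> > 1" using lam1 by simp
    have bound: "0 \<le> \<beta> ^ overflow m k X - 1" "\<beta> ^ overflow m k X - 1 \<le> \<beta> ^ m"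
      "0 \<le> \<beta> ^ overflow m k X" "\<beta> ^ overflow m k X \<le> \<beta> ^ m" for X
    proof -
      have "\<beta> ^ overflow m k X \<le> \<beta> ^ m" "1 \<le> \<beta> ^ overflow m k X"
        using lam1 overflow_le by (auto intro: power_increasing)
      then show "0 \<le> \<beta> ^ overflow m k X - 1" "\<beta> ^ overflow m k X - 1 \<le> \<beta> ^ m"
        "0 \<le> \<beta> ^ overflow m k X" "\<beta> ^ overflow m k X \<le> \<beta> ^ m" by linarith+
    qed
    have "(\<beta> - 1) * measure_pmf.prob (order_law p t) ?A
        = (\<integral>X. (\<beta> - 1) * indicator ?A X \<partial>order_law p t)" by simp
    also have "\<dots> \<le> (\<integral>X. \<beta> ^ overflow m k X - 1 \<partial>order_law p t)"
    proof (rule integral_mono)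
      show "integrable (measure_pmf (order_law p t)) (\<lambda>X. \<beta> ^ overflow m k X - 1)"
        by (rule measure_pmf.integrable_const_bound[where B="\<beta> ^ m"])
           (use bound in auto)
      show "(\<beta> - 1) * indicator ?A X \<le> \<beta> ^ overflow m k X - 1" for X
      proof (cases "X \<in> ?A")
        case True
        then have "overflow m k X \<noteq> 0" by (auto simp: overflow_def)
        then have "\<beta> ^ 1 \<le> \<beta> ^ overflow m k X" using lam1 by (intro power_increasing) auto
        then show ?thesis using True by simp
      next
        case False
        then show ?thesis using lam1 by simp
      qed
      show "integrable (measure_pmf (order_law p t)) (\<lambda>X. (\<beta> - 1) * indicator ?A X)"
        by (rule measure_pmf.integrable_const_bound[where B="\<beta> - 1"])
           (use lam1 in \<open>auto simp: indicator_def\<close>)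
    qed
    also have "\<dots> = (\<integral>X. \<beta> ^ overflow m k X \<partial>order_law p t) - 1"
    proof -
      have "integrable (measure_pmf (order_law p t)) (\<lambda>X. \<beta> ^ overflow m k X)"
        by (rule measure_pmf.integrable_const_bound[where B="\<beta> ^ m"])
           (use bound in \<open>auto intro: order_trans\<close>)
      then show ?thesis by simp
    qed
    also have "\<dots> \<le> (\<beta> ^ m - 1) / \<beta> ^ k" using E by simp
    also have "\<dots> = (\<beta> - 1) * ((\<Sum>i<m. \<beta> ^ i) / \<beta> ^ k)"
      by (simp add: power_diff_1_eq)
    finally have "measure_pmf.prob (order_law p t) ?A \<le> (\<Sum>i<m. \<beta> ^ i) / \<beta> ^ k"
      using lam2 by (subst (asm) mult_le_cancel_left_pos) auto
    also have "\<dots> \<le> (\<Sum>i<m. \<beta> ^ m) / \<beta> ^ k"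
      using lam1 by (intro divide_right_mono sum_mono power_increasing) auto
    also have "\<dots> = real m * (1 / \<beta>) ^ (k - m)"
      using lam1 mk by (simp add: power_diff power_one_over)
    finally show ?thesis by (simp add: q)
  qed
qed

section \<open>Cost tail and request tail\<close>
definition cost_tail :: "nat pmf \<Rightarrow> nat \<Rightarrow> nat \<Rightarrow> real" where
  "cost_tail p t x = (\<integral>X. measure_pmf.prob p {r. X r > x} \<partial>order_law p t)"

definition request_tail :: "nat pmf \<Rightarrow> nat \<Rightarrow> real" where
  "request_tail p x = measure_pmf.prob p {r. r > x}"

lemma integrable_prob_pmf:
  "integrable (measure_pmf P) (\<lambda>X. measure_pmf.prob p (A X))"
  by (rule measure_pmf.integrable_const_bound[where B=1]) auto

text \<open>
  Exchange argument: \<open>S\<close> and \<open>{1..n}\<close> differ by equally many items, and \<open>pmf p n\<close> separates the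
  probabilities on the two differences.
\<close>
lemma prob_le_prob_initial:
  fixes p :: "nat pmf"
  assumes anti: "\<And>i j. 1 \<le> i \<Longrightarrow> i \<le> j \<Longrightarrow> pmf p j \<le> pmf p i"
    and S: "finite S" "card S = n" "0 \<notin> S"
  shows "measure_pmf.prob p S \<le> measure_pmf.prob p {1..n}"
proof -
  let ?U = "{1..n}"
  have card: "card (S - ?U) = card (?U - S)"
    using card_Diff_subset_Int[of S ?U] card_Diff_subset_Int[of ?U S] S by (simp add: inf_commute)
  have "sum (pmf p) (S - ?U) \<le> of_nat (card (S - ?U)) * pmf p n"
  proof (rule sum_bounded_above)
    fix i assume i: "i \<in> S - ?U"
    then have "i > n" using S(3) by (cases i) auto
    moreover have "n \<ge> 1" using S i by (metis DiffD1 One_nat_def Suc_leI card_gt_0_iff empty_iff)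
    ultimately show "pmf p i \<le> pmf p n" by (intro anti) auto
  qed
  also have "\<dots> = of_nat (card (?U - S)) * pmf p n" by (simp only: card)
  also have "\<dots> \<le> sum (pmf p) (?U - S)"
    by (rule sum_bounded_below) (auto intro: anti)
  finally have "sum (pmf p) (S - ?U) + sum (pmf p) (S \<inter> ?U) \<le> sum (pmf p) (?U - S) + sum (pmf p) (?U \<inter> S)"
    by (simp add: inf_commute)
  then have "sum (pmf p) S \<le> sum (pmf p) ?U"
    using sum.Int_Diff[of S "pmf p" ?U] sum.Int_Diff[of ?U "pmf p" S] S(1) by simp
  then show ?thesis using S(1) by (simp add: measure_measure_pmf_finite)
qed

lemma request_tail_le_cost_tail:
  fixes p :: "nat pmf"
  assumes items: "set_pmf p \<subseteq> {1..}"
    and anti: "\<And>i j. 1 \<le> i \<Longrightarrow> i \<le> j \<Longrightarrow> pmf p j \<le> pmf p i"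
  shows "request_tail p x \<le> cost_tail p t x"
proof -
  \<comment> \<open>The dummy item 0 occupies position 0 and has probability 0.\<close>
  have p0: "measure_pmf.prob p (insert 0 A) = measure_pmf.prob p A" for A
  proof -
    have "AE r in measure_pmf p. (r \<in> insert 0 A) = (r \<in> A)"
      using items by (auto simp: AE_measure_pmf_iff)
    then show ?thesis by (intro measure_pmf.finite_measure_eq_AE) auto
  qed
  have "request_tail p x \<le> measure_pmf.prob p {r. X r > x}" if "X \<in> set_pmf (order_law p t)" for X
  proof -
    have X: "bij X" "X 0 = 0" using order_law_support[OF that] by auto
    define S where "S = X -` {1..x}"
    have S: "finite S" "card S = x" "0 \<notin> S"
      using X unfolding S_def
      by (auto simp: finite_vimageI bij_is_inj card_vimage_inj bij_is_surj)
    have "measure_pmf.prob p {r. X r > x} = 1 - measure_pmf.prob p S"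
    proof -
      have "{r. X r > x} = UNIV - insert 0 S"
      proof -
        have "X r > x \<longleftrightarrow> r \<noteq> 0 \<and> \<not> (1 \<le> X r \<and> X r \<le> x)" for r
          using X(2) injD[OF bij_is_inj[OF X(1)], of r 0] by (cases "r = 0") auto
        then show ?thesis by (auto simp only: S_def vimage_def mem_Collect_eq Diff_iff insert_iff
          atLeastAtMost_iff UNIV_I)
      qed
      then show ?thesis using measure_pmf.prob_compl[of "insert 0 S" p] by (simp add: p0)
    qed
    moreover have "request_tail p x = 1 - measure_pmf.prob p {1..x}"
    proof -
      have "{r. r > x} = UNIV - insert 0 {1..x}" by auto
      then show ?thesis using measure_pmf.prob_compl[of "insert 0 {1..x}" p]
        unfolding request_tail_def by (simp add: p0)
    qed
    ultimately show ?thesis using prob_le_prob_initial[OF anti S] by simp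
  qed
  then have "(\<integral>X. request_tail p x \<partial>order_law p t) \<le> cost_tail p t x"
    unfolding cost_tail_def
    by (intro integral_mono_AE) (auto simp: AE_measure_pmf_iff integrable_prob_pmf)
  then show ?thesis by simp
qed

text \<open>
  An item above \<open>n\<close> is charged in full; every other item is charged when it lies behind \<open>x\<close>.
\<close>
lemma cost_tail_le:
  fixes p :: "nat pmf"
  assumes items: "set_pmf p \<subseteq> {1..}"
  shows "cost_tail p t x
    \<le> request_tail p n + (\<Sum>i=1..n. pmf p i * measure_pmf.prob (order_law p t) {X. X i > x})"
proof -
  have int: "integrable (measure_pmf (order_law p t)) (\<lambda>X. pmf p i * indicator {X. X i > x} X)" for i
    by (rule measure_pmf.integrable_const_bound[where B=1]) (auto simp: indicator_def pmf_le_1)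
  have "measure_pmf.prob p {r. X r > x} \<le> request_tail p n + (\<Sum>i=1..n. pmf p i * indicator {X. X i > x} X)"
    for X
  proof -
    let ?A = "{i \<in> {1..n}. X i > x}"
    have "measure_pmf.prob p {r. X r > x} \<le> measure_pmf.prob p ({r. r > n} \<union> ?A)"
      by (rule measure_pmf.finite_measure_mono_AE)
         (use items in \<open>auto simp: AE_measure_pmf_iff\<close>)
    also have "\<dots> \<le> request_tail p n + measure_pmf.prob p ?A"
      unfolding request_tail_def by (rule measure_Un_le) auto
    also have "measure_pmf.prob p ?A = (\<Sum>i\<in>?A. pmf p i)"
      by (rule measure_measure_pmf_finite) auto
    also have "\<dots> = (\<Sum>i=1..n. pmf p i * indicator {X. X i > x} X)"
      by (rule sum.mono_neutral_cong_left) auto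
    finally show ?thesis .
  qed
  then have "cost_tail p t x
    \<le> (\<integral>X. request_tail p n + (\<Sum>i=1..n. pmf p i * indicator {X. X i > x} X) \<partial>order_law p t)"
    unfolding cost_tail_def
    by (intro integral_mono integrable_prob_pmf Bochner_Integration.integrable_add
        Bochner_Integration.integrable_sum int) auto
  also have "\<dots> = request_tail p n + (\<Sum>i=1..n. pmf p i * measure_pmf.prob (order_law p t) {X. X i > x})"
  proof -
    have "(\<integral>X. request_tail p n + (\<Sum>i=1..n. pmf p i * indicator {X. X i > x} X) \<partial>order_law p t)
      = (\<integral>X. request_tail p n \<partial>order_law p t)
        + (\<integral>X. (\<Sum>i=1..n. pmf p i * indicator {X. X i > x} X) \<partial>order_law p t)"
      by (intro Bochner_Integration.integral_add Bochner_Integration.integrable_sum int) auto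
    also have "(\<integral>X. (\<Sum>i=1..n. pmf p i * indicator {X. X i > x} X) \<partial>order_law p t)
      = (\<Sum>i=1..n. (\<integral>X. pmf p i * indicator {X. X i > x} X \<partial>order_law p t))"
      by (intro Bochner_Integration.integral_sum int)
    finally show ?thesis by simp
  qed
  finally show ?thesis .
qed

text \<open>
  Uniformity in \<open>t\<close> of the lower bound makes the inner limsup harmless.
\<close>
lemma limsup_eq_1_if_ratio_close:
  fixes f :: "nat \<Rightarrow> nat \<Rightarrow> real"
  assumes le: "\<And>x t. x \<ge> 1 \<Longrightarrow> f x t \<le> 1"
    and ge: "\<And>\<epsilon>. \<epsilon> > 0 \<Longrightarrow> \<forall>\<^sub>F x in sequentially. \<forall>t. f x t \<ge> 1 - \<epsilon>"
  shows "limsup (\<lambda>x. limsup (\<lambda>t. ereal (f x t))) = 1"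
proof (rule antisym)
  have "limsup (\<lambda>t. ereal (f x t)) \<le> 1" if "x \<ge> 1" for x
    by (rule Limsup_bounded) (use le[OF that] in auto)
  then show "limsup (\<lambda>x. limsup (\<lambda>t. ereal (f x t))) \<le> 1"
    by (intro Limsup_bounded) (auto intro!: eventually_sequentiallyI[of 1])
  show "1 \<le> limsup (\<lambda>x. limsup (\<lambda>t. ereal (f x t)))"
  proof (rule ereal_le_epsilon2)
    fix \<epsilon> :: real assume e: "0 < \<epsilon>"
    have "ereal (1 - \<epsilon>) \<le> limsup (\<lambda>x. limsup (\<lambda>t. ereal (f x t)))"
    proof (rule le_Limsup)
      show "\<forall>\<^sub>F x in sequentially. ereal (1 - \<epsilon>) \<le> limsup (\<lambda>t. ereal (f x t))"
        using ge[OF e]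
      proof eventually_elim
        case (elim x)
        then show ?case by (intro le_Limsup) auto
      qed
    qed auto
    then have "ereal (1 - \<epsilon>) + ereal \<epsilon> \<le> limsup (\<lambda>x. limsup (\<lambda>t. ereal (f x t))) + ereal \<epsilon>"
      by (rule add_right_mono)
    then show "1 \<le> limsup (\<lambda>x. limsup (\<lambda>t. ereal (f x t))) + ereal \<epsilon>" by (simp add: one_ereal_def)
  qed
qed

text \<open>
  Both logarithms are negative, so an upper bound on the cost tail is a lower bound on the ratio.
\<close>
lemma limsup_ratio_eq_1:
  fixes p :: "nat pmf"
  assumes items: "set_pmf p \<subseteq> {1..}"
    and pos: "\<And>i. i \<ge> 1 \<Longrightarrow> pmf p i > 0"
    and anti: "\<And>i j. 1 \<le> i \<Longrightarrow> i \<le> j \<Longrightarrow> pmf p j \<le> pmf p i"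
    and upper: "\<And>\<epsilon>. \<epsilon> > 0 \<Longrightarrow> \<epsilon> < 1 \<Longrightarrow>
       \<forall>\<^sub>F x in sequentially. \<forall>t. cost_tail p t x \<le> request_tail p x powr (1 - \<epsilon>)"
  shows "limsup (\<lambda>x. limsup (\<lambda>t. ereal (ln (cost_tail p t x) / ln (request_tail p x)))) = 1"
proof (rule limsup_eq_1_if_ratio_close)
  have T0: "request_tail p x > 0" for x
  proof -
    have "pmf p (Suc x) \<le> request_tail p x"
      unfolding request_tail_def measure_pmf_single[symmetric]
      by (rule measure_pmf.finite_measure_mono) auto
    then show ?thesis using pos[of "Suc x"] by simp
  qed
  have T1: "request_tail p x < 1" if "x \<ge> 1" for x
  proof -
    have "request_tail p x \<le> measure_pmf.prob p (UNIV - {1})"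
      unfolding request_tail_def by (rule measure_pmf.finite_measure_mono) (use that in auto)
    also have "\<dots> = 1 - pmf p 1"
      using measure_pmf.prob_compl[of "{1}" p] by (simp add: measure_pmf_single)
    finally show ?thesis using pos[of 1] by simp
  qed
  have CT: "request_tail p x \<le> cost_tail p t x" for x t
    by (rule request_tail_le_cost_tail[OF items anti])
  show "ln (cost_tail p t x) / ln (request_tail p x) \<le> 1" if "x \<ge> 1" for x t
  proof -
    have "ln (request_tail p x) \<le> ln (cost_tail p t x)"
      using T0[of x] CT[of x t] by simp
    moreover have "ln (request_tail p x) < 0" using T0[of x] T1[OF that] by simp
    ultimately show ?thesis by (simp add: divide_le_eq_1)
  qed
  show "\<forall>\<^sub>F x in sequentially. \<forall>t. 1 - \<epsilon> \<le> ln (cost_tail p t x) / ln (request_tail p x)"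
    if "\<epsilon> > 0" for \<epsilon>
  proof -
    define \<delta> where "\<delta> = min \<epsilon> (1/2)"
    have d: "\<delta> > 0" "\<delta> < 1" "\<delta> \<le> \<epsilon>" using that by (auto simp: \<delta>_def)
    show ?thesis using upper[OF d(1,2)] eventually_ge_at_top[of 1]
    proof eventually_elim
      case (elim x)
      show ?case
      proof
        fix t
        have "cost_tail p t x > 0" using T0[of x] CT[of x t] by linarith
        then have "ln (cost_tail p t x) \<le> (1 - \<delta>) * ln (request_tail p x)"
          using elim(1) T0[of x] by (metis ln_le_cancel_iff ln_powr powr_gt_zero less_irrefl)
        moreover have "ln (request_tail p x) < 0" using T0[of x] T1[OF elim(2)] by simp
        ultimately have "1 - \<delta> \<le> ln (cost_tail p t x) / ln (request_tail p x)"
          by (simp add: le_divide_eq)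
        then show "1 - \<epsilon> \<le> ln (cost_tail p t x) / ln (request_tail p x)" using d by simp
      qed
    qed
  qed
qed

section \<open>Power laws\<close>
lemma request_tail_le_if_sums_le:
  assumes "\<And>N. (\<Sum>i\<in>{n<..N}. pmf p i) \<le> B"
  shows "request_tail p n \<le> B"
proof -
  have "(\<lambda>N. measure_pmf.prob p {n<..N}) \<longlonglongrightarrow> measure_pmf.prob p (\<Union>N. {n<..N})"
    by (rule measure_pmf.finite_Lim_measure_incseq) (auto simp: incseq_def)
  also have "(\<Union>N. {n<..N}) = {r. r > n}" by auto
  finally have "(\<lambda>N. measure_pmf.prob p {n<..N}) \<longlonglongrightarrow> request_tail p n"
    by (simp add: request_tail_def)
  then show ?thesis
    by (rule LIMSEQ_le_const2) (use assms in \<open>auto simp: measure_measure_pmf_finite\<close>)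
qed

lemma sum_pmf_le_request_tail:
  assumes "finite A" "\<And>i. i \<in> A \<Longrightarrow> i > n"
  shows "(\<Sum>i\<in>A. pmf p i) \<le> request_tail p n"
proof -
  have "measure_pmf.prob p A \<le> request_tail p n"
    unfolding request_tail_def by (rule measure_pmf.finite_measure_mono) (use assms(2) in auto)
  then show ?thesis by (simp add: measure_measure_pmf_finite assms(1))
qed

text \<open>
  A zero constant would make \<open>p\<close> vanish on its support; this avoids evaluating the series in the
  definition.
\<close>
lemma power_law_constant:
  assumes "set_pmf p \<subseteq> {1..}" "power_law p \<alpha>"
  shows "\<exists>c>0. \<forall>i\<ge>1. pmf p i = c * real i powr (- \<alpha>)"
proof -
  define c where "c = inverse (\<Sum>\<^sub>\<infinity>j\<in>{1..}. real j powr (- \<alpha>))"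
  have p: "pmf p i = c * real i powr (- \<alpha>)" if "i \<ge> 1" for i
    using assms(2) that by (simp add: power_law_def c_def)
  have "c \<ge> 0" unfolding c_def by (simp add: infsum_nonneg)
  moreover have "c \<noteq> 0"
  proof
    assume "c = 0"
    obtain i where i: "i \<in> set_pmf p" using set_pmf_not_empty[of p] by blast
    then have "i \<ge> 1" using assms(1) by auto
    then show False using p[of i] i \<open>c = 0\<close> by (simp add: set_pmf_iff)
  qed
  ultimately have "c > 0" by simp
  then show ?thesis using p by (intro exI[of _ c]) simp
qed

text \<open>
  A factor \<open>i powr (- s)\<close> is pulled out of each term at its largest value, leaving a convergent series.
  This loses an arbitrarily small power against the true order \<open>n powr (1 - \<alpha>)\<close>.
\<close>
lemma power_law_request_tail_le:
  fixes p :: "nat pmf"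
  assumes c: "c > 0" and p: "\<And>i. i \<ge> 1 \<Longrightarrow> pmf p i = c * real i powr (- \<alpha>)"
    and s: "0 < s" "s < \<alpha> - 1"
  obtains K where "\<And>n. n \<ge> 1 \<Longrightarrow> request_tail p n \<le> K * real n powr (- s)"
proof -
  have sum: "summable (\<lambda>i. real i powr (s - \<alpha>))"
    using s by (simp add: summable_real_powr_iff)
  define Z where "Z = (\<Sum>i. real i powr (s - \<alpha>))"
  have "request_tail p n \<le> (c * Z) * real n powr (- s)" if n: "n \<ge> 1" for n
  proof (rule request_tail_le_if_sums_le)
    fix N
    have "pmf p i \<le> c * real n powr (- s) * real i powr (s - \<alpha>)" if "i \<in> {n<..N}" for i
    proof -
      have "real i powr (- \<alpha>) = real i powr (- s) * real i powr (s - \<alpha>)"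
        by (simp add: powr_add[symmetric])
      also have "\<dots> \<le> real n powr (- s) * real i powr (s - \<alpha>)"
        using that n s by (intro mult_right_mono powr_mono2') auto
      finally show ?thesis using p[of i] that n c by simp
    qed
    then have "(\<Sum>i\<in>{n<..N}. pmf p i) \<le> c * real n powr (- s) * (\<Sum>i\<in>{n<..N}. real i powr (s - \<alpha>))"
      by (subst sum_distrib_left) (rule sum_mono)
    also have "\<dots> \<le> c * real n powr (- s) * Z"
      unfolding Z_def using c by (intro mult_left_mono sum_le_suminf[OF sum]) auto
    finally show "(\<Sum>i\<in>{n<..N}. pmf p i) \<le> (c * Z) * real n powr (- s)" by (simp add: mult_ac)
  qed
  then show ?thesis using that by blast
qed

text \<open>
  The items in \<open>{x<..2 * x}\<close> alone have at least this mass.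
\<close>
lemma power_law_request_tail_ge:
  fixes p :: "nat pmf"
  assumes c: "c > 0" and p: "\<And>i. i \<ge> 1 \<Longrightarrow> pmf p i = c * real i powr (- \<alpha>)"
    and \<alpha>: "\<alpha> > 0" and x: "x \<ge> 1"
  shows "c * 2 powr (- \<alpha>) * real x powr (1 - \<alpha>) \<le> request_tail p x"
proof -
  have "c * 2 powr (- \<alpha>) * real x powr (1 - \<alpha>) = (\<Sum>i\<in>{x<..2*x}. c * real (2 * x) powr (- \<alpha>))"
    using x by (simp add: powr_mult powr_diff powr_minus field_simps)
  also have "\<dots> \<le> (\<Sum>i\<in>{x<..2*x}. pmf p i)"
  proof (rule sum_mono)
    fix i assume i: "i \<in> {x<..2*x}"
    have "real (2 * x) powr (- \<alpha>) \<le> real i powr (- \<alpha>)"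
      using i \<alpha> by (intro powr_mono2') auto
    then show "c * real (2 * x) powr (- \<alpha>) \<le> pmf p i"
      using p[of i] i c by simp
  qed
  also have "\<dots> \<le> request_tail p x" by (rule sum_pmf_le_request_tail) auto
  finally show ?thesis .
qed

lemma cost_tail_le_single_cut:
  fixes p :: "nat pmf"
  assumes items: "set_pmf p \<subseteq> {1..}"
    and mono: "\<And>i. i \<ge> 1 \<Longrightarrow> pmf p (Suc i) \<le> pmf p i"
    and m: "m \<ge> 1" and pos: "pmf p (Suc m) > 0" and mx: "m \<le> x"
  shows "cost_tail p t x \<le> request_tail p m + real m * (pmf p (Suc m) / pmf p m) ^ (x - m)"
proof -
  let ?P = "measure_pmf.prob (order_law p t) {X. \<exists>i\<in>{1..m}. X i > x}"
  have "(\<Sum>i=1..m. pmf p i * measure_pmf.prob (order_law p t) {X. X i > x}) \<le> (\<Sum>i=1..m. pmf p i * ?P)"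
    by (intro sum_mono mult_left_mono measure_pmf.finite_measure_mono) auto
  also have "\<dots> = measure_pmf.prob p {1..m} * ?P"
    by (simp add: measure_measure_pmf_finite sum_distrib_right)
  also have "\<dots> \<le> ?P" by (simp add: mult_left_le_one_le)
  also have "\<dots> \<le> real m * (pmf p (Suc m) / pmf p m) ^ (x - m)"
    by (rule prob_some_large_position[OF mono m pos mx])
  finally show ?thesis using cost_tail_le[OF items, of t x m] by simp
qed

text \<open>
  The cut \<open>m = \<lfloor>x powr u\<rfloor>\<close> with \<open>u < 1\<close> is polynomially shorter than \<open>x\<close>. The tail above \<open>m\<close> is of
  order \<open>x powr (- u s)\<close>, while the drift term is about \<open>x * exp (- (x powr (1 - u)))\<close> at most, since
  \<open>pmf p (Suc m) / pmf p m \<le> exp (- 1 / (m + 1))\<close>. The exponents \<open>u\<close> and \<open>s\<close> lose a factor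
  \<open>1 - \<epsilon> / 3\<close> each, together less than the allowed \<open>1 - \<epsilon>\<close>.
\<close>
lemma power_law_cost_tail_le:
  fixes p :: "nat pmf"
  assumes items: "set_pmf p \<subseteq> {1..}"
    and mono: "\<And>i. i \<ge> 1 \<Longrightarrow> pmf p (Suc i) \<le> pmf p i"
    and c: "c > 0" and p: "\<And>i. i \<ge> 1 \<Longrightarrow> pmf p i = c * real i powr (- \<alpha>)"
    and \<alpha>: "\<alpha> > 1" and \<epsilon>: "0 < \<epsilon>" "\<epsilon> < 1"
  shows "\<forall>\<^sub>F x in sequentially. \<forall>t. cost_tail p t x \<le> request_tail p x powr (1 - \<epsilon>)"
proof -
  define s where "s = (\<alpha> - 1) * (1 - \<epsilon> / 3)"
  define u where "u = 1 - \<epsilon> / 3"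
  define w where "w = (\<alpha> - 1) * (1 - \<epsilon>)"
  have s: "0 < s" "s < \<alpha> - 1" using \<alpha> \<epsilon> by (auto simp: s_def)
  have u: "0 < u" "u < 1" using \<epsilon> by (auto simp: u_def)
  have w: "0 < w" "w < u * s"
  proof -
    show "0 < w" using \<alpha> \<epsilon> by (simp add: w_def)
    have "0 < \<epsilon> / 3 * (1 + \<epsilon> / 3)" using \<epsilon> by simp
    then have "1 - \<epsilon> < (1 - \<epsilon> / 3) * (1 - \<epsilon> / 3)" by (simp add: algebra_simps)
    then show "w < u * s" using \<alpha> by (simp add: w_def u_def s_def mult_ac)
  qed
  obtain K where K: "\<And>n. n \<ge> 1 \<Longrightarrow> request_tail p n \<le> K * real n powr (- s)"
    using power_law_request_tail_le[OF c p s] by blast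
  have K0: "K \<ge> 0" using K[of 1] by (simp add: request_tail_def) (smt (verit) measure_nonneg)
  define k where "k = (c * 2 powr (- \<alpha>)) powr (1 - \<epsilon>)"
  have k: "k > 0" using c by (simp add: k_def)
  have "((\<lambda>x::real. (K * (x powr u - 1) powr (- s) + x * exp (- (x - x powr u) / (x powr u + 1))) * x powr w)
      \<longlongrightarrow> 0) at_top"
    using u s(1) w by real_asymp
  then have "\<forall>\<^sub>F x::real in at_top. (K * (x powr u - 1) powr (- s)
      + x * exp (- (x - x powr u) / (x powr u + 1))) * x powr w < k"
    using k by (auto simp: order_tendsto_iff)
  then have "\<forall>\<^sub>F x in sequentially. (K * (real x powr u - 1) powr (- s)
      + real x * exp (- (real x - real x powr u) / (real x powr u + 1))) * real x powr w < k"
    using filterlim_real_sequentially by (rule eventually_compose_filterlim)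
  moreover have "\<forall>\<^sub>F x in sequentially. real x powr u > 2" using u by real_asymp
  ultimately show ?thesis using eventually_ge_at_top[of 1]
  proof eventually_elim
    case (elim x)
    define m where "m = nat \<lfloor>real x powr u\<rfloor>"
    have m: "real m \<le> real x powr u" "real x powr u - 1 < real m"
      using elim(2) unfolding m_def by linarith+
    have m1: "m \<ge> 1" using m elim(2) by linarith
    have "real x powr u \<le> real x powr 1" using u elim(3) by (intro powr_mono) auto
    then have mx: "m \<le> x" using m by simp
    show ?case
    proof
      fix t
      have "pmf p (Suc m) / pmf p m = (real m / real (Suc m)) powr \<alpha>"
        using m1 c by (simp add: p powr_divide powr_minus field_simps)
      also have "\<dots> \<le> (real m / real (Suc m)) powr 1"
        using m1 \<alpha> by (intro powr_mono') auto
      also have "\<dots> = 1 + (- (1 / real (Suc m)))" using m1 by (simp add: field_simps)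
      also have "\<dots> \<le> exp (- (1 / real (Suc m)))" by (rule exp_ge_add_one_self)
      finally have "(pmf p (Suc m) / pmf p m) ^ (x - m) \<le> exp (- (1 / real (Suc m))) ^ (x - m)"
        by (intro power_mono) auto
      also have "\<dots> = exp (- (real (x - m) / real (Suc m)))"
        by (simp add: exp_of_nat_mult[symmetric])
      also have "\<dots> \<le> exp (- (real x - real x powr u) / (real x powr u + 1))"
      proof -
        have "(real x - real x powr u) / (real x powr u + 1) \<le> real (x - m) / real (Suc m)"
          using m mx by (intro frac_le) auto
        then show ?thesis
          by (simp only: exp_le_cancel_iff minus_divide_left[symmetric] neg_le_iff_le)
      qed
      finally have 1: "real m * (pmf p (Suc m) / pmf p m) ^ (x - m)
          \<le> real x * exp (- (real x - real x powr u) / (real x powr u + 1))"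
        using mx by (intro mult_mono) auto
      have "request_tail p m \<le> K * real m powr (- s)" by (rule K[OF m1])
      also have "\<dots> \<le> K * (real x powr u - 1) powr (- s)"
        using K0 s m elim(2) by (intro mult_left_mono powr_mono2') auto
      finally have 2: "request_tail p m \<le> K * (real x powr u - 1) powr (- s)" .
      have pos: "pmf p (Suc m) > 0" using p[of "Suc m"] c by simp
      have "cost_tail p t x \<le> K * (real x powr u - 1) powr (- s)
          + real x * exp (- (real x - real x powr u) / (real x powr u + 1))"
        using cost_tail_le_single_cut[OF items mono m1 pos mx, of t] 1 2 by simp
      also have "\<dots> \<le> k / real x powr w" using elim(1,3) by (simp add: pos_le_divide_eq)
      also have "\<dots> = (c * 2 powr (- \<alpha>) * real x powr (1 - \<alpha>)) powr (1 - \<epsilon>)"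
        using c elim(3) unfolding k_def w_def
        by (simp add: powr_mult powr_powr powr_minus_divide[symmetric] algebra_simps powr_minus divide_inverse)
           (simp add: powr_minus[symmetric] algebra_simps)
      also have "\<dots> \<le> request_tail p x powr (1 - \<epsilon>)"
        using power_law_request_tail_ge[OF c p _ elim(3)] \<alpha> \<epsilon> c
        by (intro powr_mono2) auto
      finally show "cost_tail p t x \<le> request_tail p x powr (1 - \<epsilon>)" .
    qed
  qed
qed

section \<open>Asymptotically geometric distributions\<close>
text \<open>
  A zero would persist, and then \<open>ln 0 = 0\<close> would force the limit 0, whereas \<open>ln \<nu> < 0\<close>.
\<close>
lemma asymptotically_geometric_pos:
  assumes mono: "\<And>i. i \<ge> 1 \<Longrightarrow> pmf p (Suc i) \<le> pmf p i"
    and geo: "asymptotically_geometric p \<nu>" and \<nu>: "0 < \<nu>" "\<nu> < 1" and i: "i \<ge> 1"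
  shows "pmf p i > 0"
proof (rule ccontr)
  assume "\<not> pmf p i > 0"
  then have i0: "pmf p i = 0"
    using pmf_nonneg[of p i] by linarith
  have "pmf p j = 0" if "j \<ge> i" for j
    using that
  proof (induction rule: dec_induct)
    case (step j)
    then show ?case using mono[of j] i by (simp add: order_antisym)
  qed (rule i0)
  then have "\<forall>\<^sub>F j in sequentially. ln (pmf p j) / real j = 0"
    by (intro eventually_sequentiallyI[of i]) simp
  then have "(\<lambda>j. ln (pmf p j) / real j) \<longlonglongrightarrow> 0" by (rule tendsto_eventually)
  then have "ln \<nu> = 0"
    using geo LIMSEQ_unique unfolding asymptotically_geometric_def by blast
  then show False using \<nu> by simp
qed

lemma asymptotically_geometric_bounds:
  fixes p :: "nat pmf"
  assumes pos: "\<And>i. i \<ge> 1 \<Longrightarrow> pmf p i > 0"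
    and geo: "asymptotically_geometric p \<nu>" and \<eta>: "\<eta> > 0"
  obtains K where "K \<ge> 0"
    "\<And>i. i \<ge> 1 \<Longrightarrow> \<bar>ln (pmf p i) - ln \<nu> * real i\<bar> \<le> \<eta> * real i + K"
proof -
  obtain N where N: "\<And>i. i \<ge> N \<Longrightarrow> \<bar>ln (pmf p i) / real i - ln \<nu>\<bar> < \<eta>"
    using geo \<eta> unfolding asymptotically_geometric_def LIMSEQ_iff real_norm_def by blast
  \<comment> \<open>The finitely many items before the asymptotics sets in go into the constant.\<close>
  define K where "K = (\<Sum>i<N. \<bar>ln (pmf p i) - ln \<nu> * real i\<bar>)"
  have "K \<ge> 0" unfolding K_def by (rule sum_nonneg) simp
  moreover have "\<bar>ln (pmf p i) - ln \<nu> * real i\<bar> \<le> \<eta> * real i + K" if i: "i \<ge> 1" for i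
  proof (cases "i < N")
    case True
    then have "\<bar>ln (pmf p i) - ln \<nu> * real i\<bar> \<le> K"
      unfolding K_def by (intro member_le_sum) auto
    moreover have "0 \<le> \<eta> * real i" using \<eta> by simp
    ultimately show ?thesis by linarith
  next
    case False
    have "\<bar>ln (pmf p i) - ln \<nu> * real i\<bar> = \<bar>ln (pmf p i) / real i - ln \<nu>\<bar> * real i"
    proof -
      have "ln (pmf p i) - ln \<nu> * real i = (ln (pmf p i) / real i - ln \<nu>) * real i"
        using i by (simp add: field_simps)
      then show ?thesis by (simp add: abs_mult)
    qed
    also have "\<dots> \<le> \<eta> * real i"
      using N[of i] False by (intro mult_right_mono) auto
    finally show ?thesis using \<open>K \<ge> 0\<close> by linarith
  qed
  ultimately show ?thesis using that by blast
qed

text \<open>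
  Some step is at least as steep as the average over the window.
\<close>
lemma exists_steep_step:
  fixes f :: "nat \<Rightarrow> real"
  assumes "f i - f (i + L) \<ge> c * real L" "L > 0"
  obtains m where "i \<le> m" "m < i + L" "f m - f (Suc m) \<ge> c"
proof -
  have "\<exists>m. i \<le> m \<and> m < i + L \<and> f m - f (Suc m) \<ge> c"
  proof (rule ccontr)
    assume *: "\<nexists>m. i \<le> m \<and> m < i + L \<and> f m - f (Suc m) \<ge> c"
    have "f i - f (i + L) = (\<Sum>m = i..<i + L. f m - f (Suc m))"
      using sum_Suc_diff'[of i "i + L" "\<lambda>m. - f m"] by simp
    also have "\<dots> < (\<Sum>m = i..<i + L. c)"
      using * assms(2) by (intro sum_strict_mono) (auto simp: not_le)
    finally show False using assms(1) by (simp add: mult.commute)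
  qed
  then show ?thesis using that by blast
qed

text \<open>
  Item \<open>i\<close> is one of the first \<open>m\<close> items for every \<open>m \<ge> i\<close>; the drift bound is used for an \<open>m\<close> in the
  window above \<open>i\<close> at which the probabilities drop by a factor of at least \<open>exp c\<close>.
\<close>
lemma prob_large_position_le_exp:
  fixes p :: "nat pmf"
  assumes mono: "\<And>i. i \<ge> 1 \<Longrightarrow> pmf p (Suc i) \<le> pmf p i"
    and pos: "\<And>i. i \<ge> 1 \<Longrightarrow> pmf p i > 0"
    and i: "1 \<le> i" and L: "L > 0" "i + L \<le> x" and c: "c \<ge> 0"
    and drop: "c * real L \<le> ln (pmf p i) - ln (pmf p (i + L))"
  shows "measure_pmf.prob (order_law p t) {X. X i > x} \<le> real x * exp (- c * (real x - real i - real L))"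
proof -
  obtain m where m: "i \<le> m" "m < i + L" "ln (pmf p m) - ln (pmf p (Suc m)) \<ge> c"
    using exists_steep_step[of c L "\<lambda>j. ln (pmf p j)" i, OF drop L(1)] by blast
  have pm: "pmf p m > 0" "pmf p (Suc m) > 0" using pos m(1) i by auto
  have "measure_pmf.prob (order_law p t) {X. X i > x}
      \<le> measure_pmf.prob (order_law p t) {X. \<exists>i\<in>{1..m}. X i > x}"
    by (rule measure_pmf.finite_measure_mono) (use m i in auto)
  also have "\<dots> \<le> real m * (pmf p (Suc m) / pmf p m) ^ (x - m)"
    by (rule prob_some_large_position[OF mono _ pm(2)]) (use m i L in auto)
  also have "\<dots> \<le> real x * exp (- c) ^ (x - m)"
  proof -
    have "pmf p (Suc m) / pmf p m = exp (ln (pmf p (Suc m)) - ln (pmf p m))"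
      using pm by (simp add: exp_diff)
    also have "\<dots> \<le> exp (- c)" using m(3) by simp
    finally show ?thesis using pm m L by (intro mult_mono power_mono) auto
  qed
  also have "exp (- c) ^ (x - m) = exp (- c * real (x - m))"
    by (simp add: exp_of_nat_mult[symmetric] mult.commute)
  also have "real x * \<dots> \<le> real x * exp (- c * (real x - real i - real L))"
  proof -
    have "c * (real x - real i - real L) \<le> c * real (x - m)"
      using m L c by (intro mult_left_mono) (auto simp: of_nat_diff)
    then show ?thesis by (intro mult_left_mono) auto
  qed
  finally show ?thesis .
qed

text \<open>
  With the items above \<open>x - L\<close> charged in full, the other terms are comparable for all \<open>i\<close>: being requested costs
  \<open>exp (- c i)\<close>, and having drifted behind \<open>x\<close> costs \<open>exp (- c (x - i - L))\<close>.
\<close>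
lemma geometric_cost_tail_bound:
  fixes p :: "nat pmf"
  assumes items: "set_pmf p \<subseteq> {1..}"
    and mono: "\<And>i. i \<ge> 1 \<Longrightarrow> pmf p (Suc i) \<le> pmf p i"
    and pos: "\<And>i. i \<ge> 1 \<Longrightarrow> pmf p i > 0"
    and c: "c > 0" and upper: "\<And>i. i \<ge> 1 \<Longrightarrow> ln (pmf p i) \<le> K - c * real i"
    and L: "L > 0" "L \<le> x"
    and drop: "\<And>i. 1 \<le> i \<Longrightarrow> i + L \<le> x \<Longrightarrow> c * real L \<le> ln (pmf p i) - ln (pmf p (i + L))"
  shows "cost_tail p t x \<le> exp K * (1 / (1 - exp (- c)) + (real x)\<^sup>2) * exp (- c * real (x - L))"
proof -
  define n where "n = x - L"
  have le: "pmf p i \<le> exp (K - c * real i)" if "i \<ge> 1" for i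
    using upper[OF that] pos[OF that] by (metis exp_le_cancel_iff exp_ln)
  have "request_tail p n \<le> exp K * (1 / (1 - exp (- c))) * exp (- c * real n)"
  proof (rule request_tail_le_if_sums_le)
    fix N
    have "(\<Sum>i\<in>{n<..N}. pmf p i) \<le> (\<Sum>i\<in>{n<..N}. exp K * exp (- c * real n) * exp (- c) ^ (i - n))"
    proof (rule sum_mono)
      fix i assume i: "i \<in> {n<..N}"
      have "exp (K - c * real i) = exp K * exp (- c * real n) * exp (- c) ^ (i - n)"
        using i by (simp add: exp_of_nat_mult[symmetric] exp_add[symmetric] of_nat_diff algebra_simps)
      then show "pmf p i \<le> exp K * exp (- c * real n) * exp (- c) ^ (i - n)"
        using le[of i] i by simp
    qed
    also have "\<dots> = exp K * exp (- c * real n) * (\<Sum>i\<in>{n<..N}. exp (- c) ^ (i - n))"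
      by (simp only: sum_distrib_left)
    also have "(\<Sum>i\<in>{n<..N}. exp (- c) ^ (i - n)) = (\<Sum>j\<in>{0<..N-n}. exp (- c) ^ j)"
      by (rule sum.reindex_bij_witness[of _ "\<lambda>j. j + n" "\<lambda>i. i - n"]) auto
    also have "\<dots> \<le> (\<Sum>j. exp (- c) ^ j)"
      using c by (intro sum_le_suminf summable_geometric) auto
    also have "(\<Sum>j. exp (- c) ^ j) = 1 / (1 - exp (- c))"
      using c by (intro suminf_geometric) auto
    finally show "(\<Sum>i\<in>{n<..N}. pmf p i) \<le> exp K * (1 / (1 - exp (- c))) * exp (- c * real n)"
      by (simp add: mult_ac)
  qed
  moreover have "(\<Sum>i=1..n. pmf p i * measure_pmf.prob (order_law p t) {X. X i > x})
      \<le> exp K * (real x)\<^sup>2 * exp (- c * real n)"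
  proof -
    have "(\<Sum>i=1..n. pmf p i * measure_pmf.prob (order_law p t) {X. X i > x})
        \<le> (\<Sum>i=1..n. exp K * real x * exp (- c * real n))"
    proof (rule sum_mono)
      fix i assume i: "i \<in> {1..n}"
      then have iL: "1 \<le> i" "i + L \<le> x" using L by (auto simp: n_def)
      have "pmf p i * measure_pmf.prob (order_law p t) {X. X i > x}
          \<le> exp (K - c * real i) * (real x * exp (- c * (real x - real i - real L)))"
        using prob_large_position_le_exp[OF mono pos iL(1) L(1) iL(2) _ drop[OF iL], of t] le[OF iL(1)] c
        by (intro mult_mono) auto
      also have "\<dots> = real x * exp (K - c * real i + - c * (real x - real i - real L))"
        by (simp only: exp_add mult_ac)
      also have "K - c * real i + - c * (real x - real i - real L) = K + - c * real n"
        using L by (simp add: n_def of_nat_diff algebra_simps)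
      finally show "pmf p i * measure_pmf.prob (order_law p t) {X. X i > x}
          \<le> exp K * real x * exp (- c * real n)" by (simp only: exp_add mult_ac)
    qed
    also have "\<dots> = real n * (exp K * real x * exp (- c * real n))" by simp
    also have "\<dots> \<le> real x * (exp K * real x * exp (- c * real n))"
      by (intro mult_right_mono) (auto simp: n_def)
    finally show ?thesis by (simp add: power2_eq_square mult_ac)
  qed
  ultimately show ?thesis
    using cost_tail_le[OF items, of t x n] unfolding n_def[symmetric] by (simp add: algebra_simps)
qed

text \<open>
  The error \<open>d\<^sup>2 x\<close> allowed in \<open>ln (pmf p i)\<close> is small against the window length \<open>L \<approx> d x\<close>, so that the
  average slope over a window is at least \<open>c = s - 3 d\<close>. The window itself costs another factor
  \<open>1 - d\<close> in the exponent. Both losses vanish with \<open>d\<close>.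
\<close>
lemma geometric_cost_tail_le:
  fixes p :: "nat pmf"
  assumes items: "set_pmf p \<subseteq> {1..}"
    and mono: "\<And>i. i \<ge> 1 \<Longrightarrow> pmf p (Suc i) \<le> pmf p i"
    and geo: "asymptotically_geometric p \<nu>" and \<nu>: "0 < \<nu>" "\<nu> < 1"
    and \<epsilon>: "0 < \<epsilon>" "\<epsilon> < 1"
  shows "\<forall>\<^sub>F x in sequentially. \<forall>t. cost_tail p t x \<le> request_tail p x powr (1 - \<epsilon>)"
proof -
  define s where "s = - ln \<nu>"
  have s: "s > 0" using \<nu> by (simp add: s_def)
  define d where "d = \<epsilon> * s / (2 * (4 + s))"
  have d0: "d > 0" using \<epsilon> s by (simp add: d_def)
  have dd: "d * (4 + s) = \<epsilon> * s / 2" using s by (simp add: d_def field_simps)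
  obtain e where e: "\<epsilon> * s = e" "e < s" using \<epsilon> s by simp
  have d1: "d < 1"
  proof -
    have "d * (4 + s) < 4 + s" unfolding dd e(1) using e(2) s by linarith
    then have "d * (4 + s) < 1 * (4 + s)" by simp
    then show ?thesis using s by (subst (asm) mult_less_cancel_right_pos) auto
  qed
  have dsq: "d\<^sup>2 \<le> d" using d0 d1 by (simp add: power2_eq_square mult_left_le)
  define c where "c = s - 3 * d"
  have c: "c > 0"
  proof -
    have "d * s > 0" using d0 s by simp
    moreover have "4 * d + d * s = e / 2" using dd e(1) by (simp add: algebra_simps)
    ultimately show ?thesis using e(2) d0 unfolding c_def by linarith
  qed
  \<comment> \<open>The decay rate of the cost bound against that of the target: this fixes the choice of \<open>d\<close>.\<close>
  have gap: "c * (1 - d) > (1 - \<epsilon>) * (s + d\<^sup>2)"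
  proof -
    have "c * (1 - d) = s - 3 * d - s * d + 3 * d\<^sup>2"
      by (simp add: c_def algebra_simps power2_eq_square)
    moreover have "(1 - \<epsilon>) * (s + d\<^sup>2) = s + d\<^sup>2 - \<epsilon> * s - \<epsilon> * d\<^sup>2"
      by (simp add: algebra_simps)
    moreover have "\<epsilon> * s = 8 * d + 2 * (s * d)" using dd by (simp add: algebra_simps)
    moreover have "s * d > 0" "\<epsilon> * d\<^sup>2 \<ge> 0" "d\<^sup>2 \<ge> 0" using s d0 \<epsilon> by auto
    ultimately show ?thesis using dsq d0 by linarith
  qed
  have pos: "pmf p i > 0" if "i \<ge> 1" for i
    using asymptotically_geometric_pos[OF mono geo \<nu> that] .
  obtain K where K0: "K \<ge> 0"
    and K: "\<And>i. i \<ge> 1 \<Longrightarrow> \<bar>ln (pmf p i) - ln \<nu> * real i\<bar> \<le> d\<^sup>2 * real i + K"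
    using asymptotically_geometric_bounds[OF pos geo, of "d\<^sup>2"] d0 by auto
  have up: "ln (pmf p i) \<le> K - (s - d\<^sup>2) * real i" and lo: "ln (pmf p i) \<ge> - K - (s + d\<^sup>2) * real i"
    if "i \<ge> 1" for i
    using K[OF that] by (auto simp: s_def algebra_simps abs_le_iff)
  have upc: "ln (pmf p i) \<le> K - c * real i" if "i \<ge> 1" for i
  proof -
    have "c * real i \<le> (s - d\<^sup>2) * real i"
      using dsq d0 by (intro mult_right_mono) (auto simp: c_def)
    then show ?thesis using up[OF that] by linarith
  qed
  define G where "G = 1 / (1 - exp (- c))"
  define \<gamma> where "\<gamma> = c * (1 - d) - (1 - \<epsilon>) * (s + d\<^sup>2)"
  have \<gamma>: "\<gamma> > 0" using gap by (simp add: \<gamma>_def)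
  have ev: "\<forall>\<^sub>F x in sequentially. exp K * (G + (real x)\<^sup>2) * exp c * exp ((1 - \<epsilon>) * (s + d\<^sup>2 + K)) * exp (- \<gamma> * real x) \<le> 1"
  proof -
    have "((\<lambda>x::nat. B * (G + (real x)\<^sup>2) * exp (- \<gamma> * real x)) \<longlongrightarrow> 0) at_top" for B
      using \<gamma> by real_asymp
    from this[of "exp K * exp c * exp ((1 - \<epsilon>) * (s + d\<^sup>2 + K))"]
    have "\<forall>\<^sub>F x::nat in sequentially. exp K * exp c * exp ((1 - \<epsilon>) * (s + d\<^sup>2 + K)) * (G + (real x)\<^sup>2) * exp (- \<gamma> * real x) < 1"
      by (auto simp: order_tendsto_iff)
    then show ?thesis by eventually_elim (simp add: mult_ac)
  qed
  have "\<forall>\<^sub>F x in sequentially. 2 * K \<le> d * (d * real x)" using d0 by real_asymp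
  moreover have "\<forall>\<^sub>F x in sequentially. d * real x + 1 \<le> real x" using d1 by real_asymp
  ultimately show ?thesis using ev eventually_ge_at_top[of 1]
  proof eventually_elim
    case (elim x)
    define L where "L = nat \<lceil>d * real x\<rceil>"
    have dx: "d * real x > 0" using d0 elim(4) by simp
    have L: "d * real x \<le> real L" "real L \<le> d * real x + 1"
      using dx unfolding L_def by linarith+
    have L0: "L > 0" using L dx by (cases L) auto
    have Lx: "L \<le> x" using L elim(2) by simp
    have drop: "c * real L \<le> ln (pmf p i) - ln (pmf p (i + L))" if i: "1 \<le> i" "i + L \<le> x" for i
    proof -
      have "ln (pmf p i) - ln (pmf p (i + L))
          \<ge> - K - (s + d\<^sup>2) * real i - (K - (s - d\<^sup>2) * real (i + L))"
        using lo[of i] up[of "i + L"] i by linarith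
      also have "- K - (s + d\<^sup>2) * real i - (K - (s - d\<^sup>2) * real (i + L))
          = s * real L - 2 * K - d\<^sup>2 * (real i + real (i + L))"
        by (simp add: algebra_simps)
      finally have 1: "s * real L - 2 * K - d\<^sup>2 * (real i + real (i + L))
         \<le> ln (pmf p i) - ln (pmf p (i + L))" .
      have "d\<^sup>2 * (real i + real (i + L)) \<le> d\<^sup>2 * (2 * real x)"
        using i by (intro mult_left_mono) auto
      also have "\<dots> = 2 * d * (d * real x)" by (simp add: power2_eq_square)
      also have "\<dots> \<le> 2 * d * real L" using L d0 by (intro mult_left_mono) auto
      finally have 2: "d\<^sup>2 * (real i + real (i + L)) \<le> 2 * d * real L" .
      have "d * (d * real x) \<le> d * real L" using L d0 by (intro mult_left_mono) auto
      then have 3: "2 * K \<le> d * real L" using elim(1) by linarith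
      show ?thesis using 1 2 3 by (simp add: c_def algebra_simps)
    qed
    show ?case
    proof
      fix t
      have "cost_tail p t x \<le> exp K * (G + (real x)\<^sup>2) * exp (- c * real (x - L))"
        unfolding G_def by (rule geometric_cost_tail_bound[OF items mono pos c upc L0 Lx drop])
      also have "\<dots> \<le> exp K * (G + (real x)\<^sup>2) * exp (- c * ((1 - d) * real x - 1))"
      proof -
        have "c * ((1 - d) * real x - 1) \<le> c * real (x - L)"
          using L Lx c by (intro mult_left_mono) (auto simp: of_nat_diff algebra_simps)
        moreover have "G \<ge> 0" using c by (simp add: G_def)
        ultimately show ?thesis by (intro mult_left_mono) auto
      qed
      also have "\<dots> = (exp K * (G + (real x)\<^sup>2) * exp c * exp ((1 - \<epsilon>) * (s + d\<^sup>2 + K)) * exp (- \<gamma> * real x))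
          * exp ((1 - \<epsilon>) * (- K - (s + d\<^sup>2) * real (Suc x)))"
      proof -
        have "- c * ((1 - d) * real x - 1) = c + (1 - \<epsilon>) * (s + d\<^sup>2 + K) + - \<gamma> * real x
            + (1 - \<epsilon>) * (- K - (s + d\<^sup>2) * real (Suc x))"
          by (simp add: \<gamma>_def algebra_simps)
        then show ?thesis by (simp only: exp_add mult_ac)
      qed
      also have "\<dots> \<le> 1 * exp ((1 - \<epsilon>) * (- K - (s + d\<^sup>2) * real (Suc x)))"
        by (rule mult_right_mono[OF elim(3)]) simp
      also have "\<dots> \<le> exp ((1 - \<epsilon>) * ln (pmf p (Suc x)))"
        using lo[of "Suc x"] \<epsilon> by (simp add: mult_left_mono)
      also have "\<dots> = pmf p (Suc x) powr (1 - \<epsilon>)"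
        using pos[of "Suc x"] by (simp add: powr_def)
      also have "\<dots> \<le> request_tail p x powr (1 - \<epsilon>)"
      proof (rule powr_mono2)
        show "pmf p (Suc x) \<le> request_tail p x"
          unfolding request_tail_def measure_pmf_single[symmetric]
          by (rule measure_pmf.finite_measure_mono) auto
      qed (use \<epsilon> in auto)
      finally show "cost_tail p t x \<le> request_tail p x powr (1 - \<epsilon>)" .
    qed
  qed
qed

theorem theorem1:
  fixes \<pi> :: "nat pmf" and M :: "'a measure" and R :: "nat \<Rightarrow> 'a \<Rightarrow> nat"
  assumes items: "set_pmf \<pi> \<subseteq> {1..}"
    and nonincreasing: "\<And>i. i \<ge> 1 \<Longrightarrow> pmf \<pi> (Suc i) \<le> pmf \<pi> i"
    and law: "(\<exists>\<alpha>>1. power_law \<pi> \<alpha>) \<or> (\<exists>\<nu>>0. \<nu> < 1 \<and> asymptotically_geometric \<pi> \<nu>)"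
    and M: "prob_space M"
    and indep: "prob_space.indep_vars M (\<lambda>_. count_space UNIV) R UNIV"
    and distr: "\<And>t i. measure M {\<omega> \<in> space M. R t \<omega> = i} = pmf \<pi> i"
  shows "limsup (\<lambda>x::nat. limsup (\<lambda>t::nat.
           ereal (ln (measure M {\<omega> \<in> space M. search_cost (\<lambda>s. R s \<omega>) t > x})
                  / ln (measure_pmf.prob \<pi> {r. r > x})))) = 1"
  proof -
  have anti: "pmf \<pi> j \<le> pmf \<pi> i" if "1 \<le> i" "i \<le> j" for i j
    using that(2,1) by (induction rule: dec_induct) (auto intro: order_trans[OF nonincreasing])
  have cost: "measure M {\<omega> \<in> space M. search_cost (\<lambda>s. R s \<omega>) t > x} = cost_tail \<pi> t x" for t x
    unfolding cost_tail_def by (rule prob_space.search_cost_tail[OF M indep distr])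
  have pos: "pmf \<pi> i > 0" if "i \<ge> 1" for i
    using law
  proof (elim disjE exE conjE)
    fix \<alpha> assume pl: "power_law \<pi> \<alpha>"
    obtain c where "c > 0" "\<forall>i\<ge>1. pmf \<pi> i = c * real i powr (- \<alpha>)"
      using power_law_constant[OF items pl] by auto
    then show ?thesis using that by simp
  next
    fix \<nu> assume geo: "0 < \<nu>" "\<nu> < 1" "asymptotically_geometric \<pi> \<nu>"
    show ?thesis by (rule asymptotically_geometric_pos[OF nonincreasing geo(3,1,2) that])
  qed
  have upper: "\<forall>\<^sub>F x in sequentially. \<forall>t. cost_tail \<pi> t x \<le> request_tail \<pi> x powr (1 - \<epsilon>)"
    if \<epsilon>: "\<epsilon> > 0" "\<epsilon> < 1" for \<epsilon>
    using law
  proof (elim disjE exE conjE)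
    fix \<alpha> assume pl: "1 < \<alpha>" "power_law \<pi> \<alpha>"
    obtain c where c: "c > 0" "\<forall>i\<ge>1. pmf \<pi> i = c * real i powr (- \<alpha>)"
      using power_law_constant[OF items pl(2)] by auto
    show ?thesis by (rule power_law_cost_tail_le[OF items nonincreasing c(1) c(2)[rule_format] pl(1) \<epsilon>])
  next
    fix \<nu> assume geo: "0 < \<nu>" "\<nu> < 1" "asymptotically_geometric \<pi> \<nu>"
    show ?thesis by (rule geometric_cost_tail_le[OF items nonincreasing geo(3,1,2) \<epsilon>])
  qed
  show ?thesis
    using limsup_ratio_eq_1[OF items pos anti upper] by (simp add: cost request_tail_def)
qed

end
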